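(* In the sensor selection setting of the context, assume that the measurement noises are uncorrelated between sensors, i.e. $\mathbf{R}_{k+n}^{is}=0$ for all $i\neq s$ and $n=1,\ldots,N$. Put $a_{k+n}^i=\mathrm{tr}\bigl((\mathbf{H}_{k+n}^i)'(\mathbf{R}_{k+n}^i)^{-1}\mathbf{H}_{k+n}^i\bigr)$ for $i=1,\ldots,L$, and for each $n$ let $a_{k+n}^{i_1}\ge a_{k+n}^{i_2}\ge\cdots\ge a_{k+n}^{i_L}$ be a rearrangement of $a_{k+n}^1,\ldots,a_{k+n}^L$ in descending order (the indices $i_1,\ldots,i_L$ depend on $n$). Consider the selection scheme $$\gamma_{k+n}^{i_1}=\cdots=\gamma_{k+n}^{i_{m_{k+n}}}=1,\qquad \gamma_{k+n}^{i_{m_{k+n}+1}}=\cdots=\gamma_{k+n}^{i_L}=0,\qquad n=1,\ldots,N.$$ All problems below are over Boolean variables $\gamma_{k+n}^i\in\{0,1\}$ subject to $\sum_{i=1}^L\gamma_{k+n}^i=m_{k+n}$, $n=1,\ldots,N$. (i) If the problem of minimizing $\mathbf{P}_{k+N|k+N}$ (in the Loewner order) has an optimal solution, then the selection scheme $\gamma_{k+n}^{i_1}=\cdots=\gamma_{k+n}^{i_{m_{k+n}}}=1$, $\gamma_{k+n}^{i_{m_{k+n}+1}}=\cdots=\gamma_{k+n}^{i_L}=0$, $n=1,\ldots,N$, is an optimal solution both of the problem of minimizing $\mathbf{P}_{k+N|k+N}$ and of the problem of minimizing $\sum_{n=1}^N\mathbf{P}_{k+n|k+n}$ (both in the Loewner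 order), and it also maximizes the information measure $\mathrm{tr}\bigl(\tilde{\mathbf{H}}_{k+n}'\tilde{\mathbf{R}}_{k+n}^{+}\tilde{\mathbf{H}}_{k+n}\bigr)$ for each $n=1,\ldots,N$. (ii) If the problem of minimizing $\mathbf{P}_{k+N|k+N}$ does not have an optimal solution, the selection scheme $\gamma_{k+n}^{i_1}=\cdots=\gamma_{k+n}^{i_{m_{k+n}}}=1$, $\gamma_{k+n}^{i_{m_{k+n}+1}}=\cdots=\gamma_{k+n}^{i_L}=0$, $n=1,\ldots,N$, is still optimal in the sense that it maximizes $\mathrm{tr}\bigl(\tilde{\mathbf{H}}_{k+n}'\tilde{\mathbf{R}}_{k+n}^{+}\tilde{\mathbf{H}}_{k+n}\bigr)$ for each $n=1,\ldots,N$.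
   Context: All matrices are real; prime denotes transpose, and the superscript $+$ denotes the Moore-Penrose generalized inverse. $A\succeq B$ (Loewner order) means $A-B$ is symmetric positive semidefinite. A feasible point $x^*$ is an optimal solution of a problem of minimizing a matrix-valued function $M$ if $M(x)\succeq M(x^* )$ for every feasible $x$ (so an optimal solution need not exist). Setting: Fix $k$, a horizon $N\ge 1$, a number of sensors $L$, and integers $0\le m_{k+n}\le L$, $n=1,\ldots,N$. The matrices $\mathbf{F}_{j}\in\mathbb{R}^{r\times r}$ are invertible, the $\mathbf{Q}_j\in\mathbb{R}^{r\times r}$ are invertible covariance matrices (symmetric positive definite), $\mathbf{H}_j^i\in\mathbb{R}^{n_i\times r}$, and $\mathbf{R}_j=(\mathbf{R}_j^{is})_{i,s=1}^L$ (blocks $\mathbf{R}_j^{is}\in\mathbb{R}^{n_i\times n_s}$) are invertible covariance matrices (symmetric positive definite), with $\mathbf{R}_j^i=\mathbf{R}_j^{ii}$. These come from the system $\mathbf{x}_{j+1}=\mathbf{F}_j\mathbf{x}_j+\mathbf{w}_j$, $\mathbf{y}_j^i=\mathbf{H}_j^i\mathbf{x}_j+\mathbf{v}_j^i$, with $\mathbf{Q}_j=\mathrm{Cov}(\mathbf{w}_j)$ and $\mathbf{R}_j^{is}=\mathrm{Cov}(\mathbf{v}_j^i,\mathbf{v}_j^s)$. For $\gamma_j^1,\ldots,\gamma_j^L\in\{0,1\}$ ($\gamma_j^i=1$ means that sensor $i$ is selected at time $j$), put $\tilde{\mathbf{H}}_j=((\gamma_j^1\mathbf{H}_j^1)',\ldots,(\gamma_j^L\mathbf{H}_j^L)')'$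 and let $\tilde{\mathbf{R}}_j$ be the block matrix with blocks $\tilde{\mathbf{R}}_j^{is}=\gamma_j^i\gamma_j^s\mathbf{R}_j^{is}$. Given the error covariance $\mathbf{P}_{k|k}$ (symmetric positive semidefinite, not depending on the decision variables), the error covariances are defined recursively for $n=1,\ldots,N$ by $$\mathbf{P}_{k+n|k+n-1}=\mathbf{F}_{k+n-1}\mathbf{P}_{k+n-1|k+n-1}\mathbf{F}_{k+n-1}'+\mathbf{Q}_{k+n-1},\qquad \mathbf{P}_{k+n|k+n}=\bigl(\mathbf{P}_{k+n|k+n-1}^{-1}+\tilde{\mathbf{H}}_{k+n}'\tilde{\mathbf{R}}_{k+n}^{+}\tilde{\mathbf{H}}_{k+n}\bigr)^{-1}.$$ Thus $\mathbf{P}_{k+n|k+n}$ is a function of $\gamma_{k+1}^1,\ldots,\gamma_{k+1}^L,\ldots,\gamma_{k+n}^1,\ldots,\gamma_{k+n}^L$. *)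

theory Defs
  imports "Jordan_Normal_Form.Gauss_Jordan_Elimination"
begin

definition tr_mat :: "real mat \<Rightarrow> real" where
  "tr_mat A = (\<Sum>i<dim_row A. A $$ (i, i))"

(* Meaningful only for invertible A. *)
definition mat_inv :: "real mat \<Rightarrow> real mat" where
  "mat_inv A = the (mat_inverse A)"

definition psd_mat :: "real mat \<Rightarrow> bool" where
  "psd_mat A \<longleftrightarrow> square_mat A \<and> transpose_mat A = A \<and>
     (\<forall>v \<in> carrier_vec (dim_row A). 0 \<le> v \<bullet> (A *\<^sub>v v))"

definition pd_mat :: "real mat \<Rightarrow> bool" where
  "pd_mat A \<longleftrightarrow> square_mat A \<and> transpose_mat A = A \<and>
     (\<forall>v \<in> carrier_vec (dim_row A). v \<noteq> 0\<^sub>v (dim_row A) \<longrightarrow> 0 < v \<bullet> (A *\<^sub>v v))"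

definition loewner_ge :: "real mat \<Rightarrow> real mat \<Rightarrow> bool" (infix "\<succeq>\<^sub>L" 50) where
  "A \<succeq>\<^sub>L B \<longleftrightarrow> dim_row A = dim_row B \<and> dim_col A = dim_col B \<and> psd_mat (A - B)"

definition loewner_optimal :: "'x set \<Rightarrow> ('x \<Rightarrow> real mat) \<Rightarrow> 'x \<Rightarrow> bool" where
  "loewner_optimal X M x0 \<longleftrightarrow> x0 \<in> X \<and> (\<forall>x\<in>X. M x \<succeq>\<^sub>L M x0)"

text \<open>The four Penrose equations; they determine the generalized inverse uniquely.\<close>

definition is_pinv :: "real mat \<Rightarrow> real mat \<Rightarrow> bool" where
  "is_pinv A X \<longleftrightarrow> X \<in> carrier_mat (dim_col A) (dim_row A) \<and>
     A * X * A = A \<and> X * A * X = X \<and>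
     transpose_mat (A * X) = A * X \<and> transpose_mat (X * A) = X * A"

definition pinv :: "real mat \<Rightarrow> real mat" where
  "pinv A = (THE X. is_pinv A X)"

lemma is_pinv_unique:
  assumes X: "is_pinv A X" and Y: "is_pinv A Y"
  shows "X = Y"
proof -
  define m n where "m = dim_row A" and "n = dim_col A"
  have c: "A \<in> carrier_mat m n" "X \<in> carrier_mat n m" "Y \<in> carrier_mat n m"
    using X Y by (auto simp: is_pinv_def m_def n_def)
  have p: "A * X \<in> carrier_mat m m" "A * Y \<in> carrier_mat m m"
    "X * A \<in> carrier_mat n n" "Y * A \<in> carrier_mat n n"
    using c by auto
  have X1: "A * X * A = A" and X2: "X * A * X = X" and X3: "transpose_mat (A * X) = A * X"
    and X4: "transpose_mat (X * A) = X * A"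
    using X by (auto simp: is_pinv_def)
  have Y1: "A * Y * A = A" and Y2: "Y * A * Y = Y" and Y3: "transpose_mat (A * Y) = A * Y"
    and Y4: "transpose_mat (Y * A) = Y * A"
    using Y by (auto simp: is_pinv_def)
  have e1: "(A * Y) * (A * X) = A * X"
    using assoc_mult_mat[OF p(2) c(1) c(2)] Y1 by simp
  have e2: "(A * X) * (A * Y) = A * Y"
    using assoc_mult_mat[OF p(1) c(1) c(3)] X1 by simp
  have AX: "A * X = A * Y"
    using transpose_mult[OF p(1) p(2)] e1 e2 X3 Y3 by simp
  have e3: "(X * A) * (Y * A) = X * A"
    using assoc_mult_mat[OF c(2) c(1) p(4)] assoc_mult_mat[OF c(1) c(3) c(1)] Y1 by simp
  have e4: "(Y * A) * (X * A) = Y * A"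
    using assoc_mult_mat[OF c(3) c(1) p(3)] assoc_mult_mat[OF c(1) c(2) c(1)] X1 by simp
  have XA: "X * A = Y * A"
    using transpose_mult[OF p(3) p(4)] e3 e4 X4 Y4 by simp
  have "X = Y * A * X" using X2 XA by simp
  also have "\<dots> = Y * (A * X)" by (rule assoc_mult_mat[OF c(3) c(1) c(2)])
  also have "\<dots> = Y * A * Y" unfolding AX by (rule assoc_mult_mat[OF c(3) c(1) c(3), symmetric])
  finally show ?thesis using Y2 by simp
qed

lemma pinv_eqI: "is_pinv A X \<Longrightarrow> pinv A = X"
  unfolding pinv_def using is_pinv_unique by blast

text \<open>Block matrix whose block in block row \<open>i < a\<close> and block column \<open>s < b\<close> is
  \<open>B i s\<close>, of size \<open>dr i \<times> dc s\<close>.\<close>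

definition blk_offset :: "(nat \<Rightarrow> nat) \<Rightarrow> nat \<Rightarrow> nat" where
  "blk_offset d i = (\<Sum>l<i. d l)"

definition blk_of :: "(nat \<Rightarrow> nat) \<Rightarrow> nat \<Rightarrow> nat" where
  "blk_of d p = (LEAST i. p < blk_offset d (Suc i))"

definition block_mat ::
  "nat \<Rightarrow> (nat \<Rightarrow> nat) \<Rightarrow> nat \<Rightarrow> (nat \<Rightarrow> nat) \<Rightarrow> (nat \<Rightarrow> nat \<Rightarrow> real mat) \<Rightarrow> real mat" where
  "block_mat a dr b dc B = mat (blk_offset dr a) (blk_offset dc b)
     (\<lambda>(p, q). B (blk_of dr p) (blk_of dc q) $$
        (p - blk_offset dr (blk_of dr p), q - blk_offset dc (blk_of dc q)))"

lemma blk_offset_mono: "i \<le> j \<Longrightarrow> blk_offset d i \<le> blk_offset d j"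
  unfolding blk_offset_def by (rule sum_mono2) auto

lemma blk_of_offset: "x < d i \<Longrightarrow> blk_of d (blk_offset d i + x) = i"
  unfolding blk_of_def
proof (rule Least_equality)
  assume x: "x < d i"
  then show "blk_offset d i + x < blk_offset d (Suc i)" by (simp add: blk_offset_def)
  fix j assume "blk_offset d i + x < blk_offset d (Suc j)"
  then show "i \<le> j" using blk_offset_mono[of "Suc j" i d] by (cases "i \<le> j") auto
qed

lemma blk_offset_less: "x < d i \<Longrightarrow> i < a \<Longrightarrow> blk_offset d i + x < blk_offset d a"
  using blk_offset_mono[of "Suc i" a d] by (simp add: blk_offset_def)

lemma block_mat_index:
  assumes "i < a" "s < b" "x < dr i" "y < dc s"
  shows "block_mat a dr b dc B $$ (blk_offset dr i + x, blk_offset dc s + y) = B i s $$ (x, y)"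
  using assms by (simp add: block_mat_def blk_of_offset blk_offset_less)

definition mat_sum :: "nat \<Rightarrow> nat \<Rightarrow> ('i \<Rightarrow> real mat) \<Rightarrow> 'i set \<Rightarrow> real mat" where
  "mat_sum nr nc M I = mat nr nc (\<lambda>(p, q). \<Sum>n\<in>I. M n $$ (p, q))"

text \<open>Sensors are numbered \<open>0, \<dots>, L - 1\<close>; sensor \<open>i\<close> has measurement dimension \<open>d i\<close>, and
  \<open>\<gamma> j i\<close> is the decision variable of sensor \<open>i\<close> at the absolute time \<open>j\<close>.\<close>

definition H_sel ::
  "nat \<Rightarrow> nat \<Rightarrow> (nat \<Rightarrow> nat) \<Rightarrow> (nat \<Rightarrow> nat \<Rightarrow> real mat) \<Rightarrow> (nat \<Rightarrow> nat \<Rightarrow> nat) \<Rightarrow> nat \<Rightarrow> real mat" where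
  "H_sel r L d H \<gamma> j = block_mat L d 1 (\<lambda>_. r) (\<lambda>i _. real (\<gamma> j i) \<cdot>\<^sub>m H j i)"

definition R_sel ::
  "nat \<Rightarrow> (nat \<Rightarrow> nat) \<Rightarrow> (nat \<Rightarrow> nat \<Rightarrow> nat \<Rightarrow> real mat) \<Rightarrow> (nat \<Rightarrow> nat \<Rightarrow> nat) \<Rightarrow> nat \<Rightarrow> real mat" where
  "R_sel L d R \<gamma> j = block_mat L d L d (\<lambda>i s. (real (\<gamma> j i) * real (\<gamma> j s)) \<cdot>\<^sub>m R j i s)"

definition info_mat ::
  "nat \<Rightarrow> nat \<Rightarrow> (nat \<Rightarrow> nat) \<Rightarrow> (nat \<Rightarrow> nat \<Rightarrow> real mat) \<Rightarrow> (nat \<Rightarrow> nat \<Rightarrow> nat \<Rightarrow> real mat) \<Rightarrow>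
   (nat \<Rightarrow> nat \<Rightarrow> nat) \<Rightarrow> nat \<Rightarrow> real mat" where
  "info_mat r L d H R \<gamma> j =
     transpose_mat (H_sel r L d H \<gamma> j) * pinv (R_sel L d R \<gamma> j) * H_sel r L d H \<gamma> j"

text \<open>\<open>err_cov r L d F Q H R k P0 \<gamma> n\<close> is the error covariance at time \<open>k + n\<close> given the measurements
  up to time \<open>k + n\<close>, where \<open>P0\<close> is the one at time \<open>k\<close>; \<open>pred_cov\<close> is the one-step prediction.\<close>

definition pred_cov :: "real mat \<Rightarrow> real mat \<Rightarrow> real mat \<Rightarrow> real mat" where
  "pred_cov Fj Qj P = Fj * P * transpose_mat Fj + Qj"

primrec err_cov ::
  "nat \<Rightarrow> nat \<Rightarrow> (nat \<Rightarrow> nat) \<Rightarrow> (nat \<Rightarrow> real mat) \<Rightarrow> (nat \<Rightarrow> real mat) \<Rightarrow> (nat \<Rightarrow> nat \<Rightarrow> real mat) \<Rightarrow>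
   (nat \<Rightarrow> nat \<Rightarrow> nat \<Rightarrow> real mat) \<Rightarrow> nat \<Rightarrow> real mat \<Rightarrow> (nat \<Rightarrow> nat \<Rightarrow> nat) \<Rightarrow> nat \<Rightarrow> real mat" where
  "err_cov r L d F Q H R k P0 \<gamma> 0 = P0"
| "err_cov r L d F Q H R k P0 \<gamma> (Suc n) =
     mat_inv (mat_inv (pred_cov (F (k + n)) (Q (k + n)) (err_cov r L d F Q H R k P0 \<gamma> n))
              + info_mat r L d H R \<gamma> (k + Suc n))"

definition feasible :: "nat \<Rightarrow> nat \<Rightarrow> nat \<Rightarrow> (nat \<Rightarrow> nat) \<Rightarrow> (nat \<Rightarrow> nat \<Rightarrow> nat) set" where
  "feasible k N L m = {\<gamma>. \<forall>n\<in>{1..N}.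
     (\<forall>i<L. \<gamma> (k + n) i \<in> {0, 1}) \<and> (\<Sum>i<L. \<gamma> (k + n) i) = m (k + n)}"

end

theory Submission
  imports Defs "Jordan_Normal_Form.Determinant"
begin

text \<open>Let \<open>\<gamma>\<close> be optimal at the horizon \<open>N\<close>. Varying only the selection at time \<open>N\<close> and
  inverting, its last information matrix dominates that of every other selection; the scheme has
  maximal trace, and two comparable matrices with equal trace coincide, so both have the same
  information matrix at time \<open>N\<close>. Varying only the earlier selections and cancelling the
  information matrix, \<open>Q\<close> and the invertible \<open>F\<close>, we see that \<open>\<gamma>\<close> is also optimal at the
  horizon \<open>N - 1\<close>. Descending in this way, the scheme has the same error covariances as \<open>\<gamma>\<close>, and these
  are optimal at every time.\<close>

section \<open>Positive definite matrices and the Loewner order\<close>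

lemma pd_imp_psd: "pd_mat A \<Longrightarrow> psd_mat A"
  unfolding pd_mat_def psd_mat_def
proof (elim conjE, intro conjI ballI)
  fix v :: "real vec" assume *: "\<forall>v\<in>carrier_vec (dim_row A). v \<noteq> 0\<^sub>v (dim_row A) \<longrightarrow> 0 < v \<bullet> (A *\<^sub>v v)"
    and v: "v \<in> carrier_vec (dim_row A)"
  show "0 \<le> v \<bullet> (A *\<^sub>v v)"
  proof (cases "v = 0\<^sub>v (dim_row A)")
    case False
    then show ?thesis using * v by (simp add: less_imp_le)
  qed (simp add: scalar_prod_def)
qed auto

lemma psd_matD:
  assumes "psd_mat A" "A \<in> carrier_mat n n"
  shows "transpose_mat A = A" "v \<in> carrier_vec n \<Longrightarrow> 0 \<le> v \<bullet> (A *\<^sub>v v)"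
  using assms by (auto simp: psd_mat_def)

lemma pd_matD:
  assumes "pd_mat A" "A \<in> carrier_mat n n"
  shows "transpose_mat A = A"
    and "v \<in> carrier_vec n \<Longrightarrow> v \<noteq> 0\<^sub>v n \<Longrightarrow> 0 < v \<bullet> (A *\<^sub>v v)"
  using assms by (auto simp: pd_mat_def)

lemma psd_matI:
  assumes "A \<in> carrier_mat n n" "transpose_mat A = A"
    and "\<And>v. v \<in> carrier_vec n \<Longrightarrow> 0 \<le> v \<bullet> (A *\<^sub>v v)"
  shows "psd_mat A"
  using assms by (auto simp: psd_mat_def)

lemma pd_matI:
  assumes "A \<in> carrier_mat n n" "transpose_mat A = A"
    and "\<And>v. v \<in> carrier_vec n \<Longrightarrow> v \<noteq> 0\<^sub>v n \<Longrightarrow> 0 < v \<bullet> (A *\<^sub>v v)"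
  shows "pd_mat A"
  using assms by (auto simp: pd_mat_def)

text \<open>The entrywise form serves where a matrix is known through its entries: sums of matrices,
  block matrices and scalar multiples.\<close>

lemma quad_form_sum:
  assumes "A \<in> carrier_mat n n" "v \<in> carrier_vec n"
  shows "v \<bullet> (A *\<^sub>v v) = (\<Sum>i<n. \<Sum>j<n. v $ i * A $$ (i, j) * v $ j)"
  using assms
  by (auto simp: scalar_prod_def sum_distrib_left mult.assoc atLeast0LessThan intro!: sum.cong)

lemma quad_form_add:
  fixes A B :: "real mat"
  assumes "A \<in> carrier_mat n n" "B \<in> carrier_mat n n" "v \<in> carrier_vec n"
  shows "v \<bullet> ((A + B) *\<^sub>v v) = v \<bullet> (A *\<^sub>v v) + v \<bullet> (B *\<^sub>v v)"
  using assms by (simp add: add_mult_distrib_mat_vec[of _ n n] scalar_prod_add_distrib[of _ n])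

lemma quad_form_minus:
  fixes A B :: "real mat"
  assumes "A \<in> carrier_mat n n" "B \<in> carrier_mat n n" "v \<in> carrier_vec n"
  shows "v \<bullet> ((A - B) *\<^sub>v v) = v \<bullet> (A *\<^sub>v v) - v \<bullet> (B *\<^sub>v v)"
  using assms by (simp add: minus_mult_distrib_mat_vec[of _ n n] scalar_prod_minus_distrib[of _ n])

lemma quad_form_congruence:
  fixes A B :: "real mat"
  assumes "A \<in> carrier_mat n n" "B \<in> carrier_mat n p" "v \<in> carrier_vec p"
  shows "v \<bullet> ((transpose_mat B * A * B) *\<^sub>v v) = (B *\<^sub>v v) \<bullet> (A *\<^sub>v (B *\<^sub>v v))"
proof -
  have c: "transpose_mat B \<in> carrier_mat p n" "B *\<^sub>v v \<in> carrier_vec n" "A *\<^sub>v (B *\<^sub>v v) \<in> carrier_vec n"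
    using assms by auto
  have "(transpose_mat B * A * B) *\<^sub>v v = transpose_mat B *\<^sub>v (A *\<^sub>v (B *\<^sub>v v))"
    using assms c by (simp add: assoc_mult_mat_vec[of _ p n] assoc_mult_mat_vec[of _ p n _ p])
  then show ?thesis
    using transpose_vec_mult_scalar[OF assms(2,3) c(3)] assms c
    by (metis comm_scalar_prod mult_mat_vec_carrier)
qed

lemma psd_congruence:
  assumes "A \<in> carrier_mat n n" "psd_mat A" "B \<in> carrier_mat n p"
  shows "psd_mat (transpose_mat B * A * B)"
proof (rule psd_matI)
  show "transpose_mat B * A * B \<in> carrier_mat p p" using assms by auto
  show "transpose_mat (transpose_mat B * A * B) = transpose_mat B * A * B"
    using assms psd_matD(1)[OF assms(2,1)]
    by (simp add: transpose_mult[of _ p n _ p] transpose_mult[of _ n n _ p] transpose_mult[of _ p n _ n]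
        assoc_mult_mat[of _ p n _ n _ p])
  show "0 \<le> v \<bullet> ((transpose_mat B * A * B) *\<^sub>v v)" if "v \<in> carrier_vec p" for v
    using quad_form_congruence[OF assms(1,3) that] psd_matD(2)[OF assms(2,1)] assms that
    by (simp add: mult_mat_vec_carrier)
qed

lemma pd_add:
  assumes "A \<in> carrier_mat n n" "B \<in> carrier_mat n n" "psd_mat A" "pd_mat B"
  shows "pd_mat (A + B)"
  using psd_matD[OF assms(3,1)] pd_matD[OF assms(4,2)] assms(1,2)
  by (intro pd_matI[of _ n]) (auto simp: transpose_add quad_form_add intro: add_nonneg_pos)

lemma loewner_iff:
  assumes "A \<in> carrier_mat n n" "B \<in> carrier_mat n n" "transpose_mat A = A" "transpose_mat B = B"
  shows "A \<succeq>\<^sub>L B \<longleftrightarrow> (\<forall>v\<in>carrier_vec n. v \<bullet> (B *\<^sub>v v) \<le> v \<bullet> (A *\<^sub>v v))"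
  using assms
  by (auto simp: loewner_ge_def psd_mat_def quad_form_minus[of _ n] transpose_minus)

section \<open>Inverses of positive definite matrices\<close>

lemma mat_inv_inverse:
  assumes A: "A \<in> carrier_mat n n" and det: "det A \<noteq> 0"
  shows "mat_inv A \<in> carrier_mat n n" "A * mat_inv A = 1\<^sub>m n" "mat_inv A * A = 1\<^sub>m n"
proof -
  \<comment> \<open>A nonzero determinant makes \<open>A\<close> a unit of the matrix ring, which
    excludes \<open>None\<close>; so the \<open>the\<close> in \<open>mat_inv\<close> returns a
    genuine inverse.\<close>
  have "mat_inverse A \<noteq> None"
    using mat_inverse(1)[OF A, where b = "()"] det_non_zero_imp_unit[OF A det, of "()"] by blast
  then have "mat_inverse A = Some (mat_inv A)" by (auto simp: mat_inv_def)
  from mat_inverse(2)[OF A this]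
  show "mat_inv A \<in> carrier_mat n n" "A * mat_inv A = 1\<^sub>m n" "mat_inv A * A = 1\<^sub>m n" by auto
qed

lemma inverse_mat_unique:
  assumes "A \<in> carrier_mat n n" "B \<in> carrier_mat n n" "C \<in> carrier_mat n n"
    and "B * A = 1\<^sub>m n" "A * C = 1\<^sub>m n"
  shows "B = (C :: real mat)"
  using assms assoc_mult_mat[of B n n A n C n] by simp

text \<open>A nonzero kernel vector would make the quadratic form vanish.\<close>

lemma pd_det:
  assumes "A \<in> carrier_mat n n" "pd_mat A"
  shows "det A \<noteq> 0"
proof
  assume "det A = 0"
  then obtain v where v: "v \<in> carrier_vec n" "v \<noteq> 0\<^sub>v n" "A *\<^sub>v v = 0\<^sub>v n"
    using det_0_iff_vec_prod_zero_field[OF assms(1)] by auto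
  with pd_matD(2)[OF assms(2,1) v(1,2)] show False by simp
qed

lemma pd_inv:
  assumes "A \<in> carrier_mat n n" "pd_mat A"
  shows "mat_inv A \<in> carrier_mat n n" "A * mat_inv A = 1\<^sub>m n" "mat_inv A * A = 1\<^sub>m n"
  using mat_inv_inverse[OF assms(1) pd_det[OF assms]] by auto

lemma mat_inv_mult_vec:
  assumes "A \<in> carrier_mat n n" "pd_mat A" "v \<in> carrier_vec n"
  shows "A *\<^sub>v (mat_inv A *\<^sub>v v) = v" "mat_inv A *\<^sub>v v \<in> carrier_vec n"
  using pd_inv[OF assms(1,2)] assms by (auto simp: assoc_mult_mat_vec[symmetric, of _ n n])

text \<open>Substituting \<open>v = A x\<close> turns the form of the inverse at \<open>v\<close>
  into the form of \<open>A\<close> at \<open>x\<close>. For symmetry, the transposed inverse is a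
  left inverse of the symmetric \<open>A\<close>, and inverses are unique.\<close>

lemma pd_mat_inv:
  assumes A: "A \<in> carrier_mat n n" and pd: "pd_mat A"
  shows "pd_mat (mat_inv A)"
proof (rule pd_matI)
  note inv = pd_inv[OF A pd] note sym = pd_matD(1)[OF pd A]
  show c: "mat_inv A \<in> carrier_mat n n" by (rule inv)
  show "transpose_mat (mat_inv A) = mat_inv A"
  proof (rule inverse_mat_unique[OF A _ c _ inv(2)])
    show "transpose_mat (mat_inv A) * A = 1\<^sub>m n"
      using transpose_mult[OF A c] inv sym by simp
  qed (use c in auto)
  fix v :: "real vec" assume v: "v \<in> carrier_vec n" "v \<noteq> 0\<^sub>v n"
  let ?x = "mat_inv A *\<^sub>v v"
  have x: "?x \<in> carrier_vec n" "A *\<^sub>v ?x = v" using mat_inv_mult_vec[OF A pd v(1)] by auto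
  have "A *\<^sub>v 0\<^sub>v n = 0\<^sub>v n" using A by (intro eq_vecI) auto
  then have "?x \<noteq> 0\<^sub>v n" using x(2) v(2) by metis
  from pd_matD(2)[OF pd A x(1) this] have "0 < ?x \<bullet> v" using x by simp
  then show "0 < v \<bullet> ?x" using comm_scalar_prod[OF x(1) v(1)] by simp
qed

lemma mat_inv_mat_inv:
  assumes A: "A \<in> carrier_mat n n" and pd: "pd_mat A"
  shows "mat_inv (mat_inv A) = A"
proof -
  note inv = pd_inv[OF A pd]
  note inv' = pd_inv[OF inv(1) pd_mat_inv[OF A pd]]
  show ?thesis by (rule inverse_mat_unique[OF inv(1) inv'(1) A inv'(3) inv(3)])
qed

text \<open>The minimum over \<open>x\<close> of \<open>x'Bx - 2x'v\<close> is \<open>-v'B\<^sup>-\<^sup>1v\<close>; evaluating at \<open>x = A\<^sup>-\<^sup>1v\<close> gives the claim.\<close>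

lemma mat_inv_antimono:
  assumes A: "A \<in> carrier_mat n n" "pd_mat A" and B: "B \<in> carrier_mat n n" "pd_mat B"
    and ge: "A \<succeq>\<^sub>L B"
  shows "mat_inv B \<succeq>\<^sub>L mat_inv A"
proof -
  note iA = pd_inv(1)[OF A] and iB = pd_inv(1)[OF B]
  have "v \<bullet> (mat_inv A *\<^sub>v v) \<le> v \<bullet> (mat_inv B *\<^sub>v v)" if v: "v \<in> carrier_vec n" for v
  proof -
    define x y where "x = mat_inv A *\<^sub>v v" and "y = mat_inv B *\<^sub>v v"
    have x: "x \<in> carrier_vec n" "A *\<^sub>v x = v" and y: "y \<in> carrier_vec n" "B *\<^sub>v y = v"
      using mat_inv_mult_vec[OF A v] mat_inv_mult_vec[OF B v] by (auto simp: x_def y_def)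
    have Bx: "B *\<^sub>v x \<in> carrier_vec n" using B x by auto
    \<comment> \<open>Completing the square: as \<open>B y = v\<close> and \<open>B\<close> is
      symmetric, expanding this yields the lower bound \<open>-(y \<bullet> v)\<close> for the
      quadratic function at \<open>x\<close>.\<close>
    have "0 \<le> (x - y) \<bullet> (B *\<^sub>v (x - y))"
      using psd_matD(2)[OF pd_imp_psd[OF B(2)] B(1)] x y by simp
    also have "B *\<^sub>v (x - y) = B *\<^sub>v x - v"
      using mult_minus_distrib_mat_vec[OF B(1) x(1) y(1)] y by simp
    also have "(x - y) \<bullet> (B *\<^sub>v x - v) = x \<bullet> (B *\<^sub>v x) - x \<bullet> v - (y \<bullet> (B *\<^sub>v x) - y \<bullet> v)"
      using x y v Bx by (simp add: minus_scalar_prod_distrib[of _ n] scalar_prod_minus_distrib[of _ n])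
    also have "y \<bullet> (B *\<^sub>v x) = x \<bullet> v"
      using transpose_vec_mult_scalar[OF B(1) x(1) y(1)] pd_matD(1)[OF B(2,1)] y x v
      by (metis comm_scalar_prod)
    finally have "2 * (x \<bullet> v) \<le> x \<bullet> (B *\<^sub>v x) + y \<bullet> v" by simp
    moreover have "x \<bullet> (B *\<^sub>v x) \<le> x \<bullet> (A *\<^sub>v x)"
      using ge loewner_iff[OF A(1) B(1) pd_matD(1)[OF A(2,1)] pd_matD(1)[OF B(2,1)]] x by auto
    ultimately have "x \<bullet> v \<le> y \<bullet> v" using x by simp
    then show ?thesis using comm_scalar_prod[OF x(1) v] comm_scalar_prod[OF y(1) v]
      by (simp add: x_def y_def)
  qed
  then show ?thesis
    using loewner_iff[OF iB iA] pd_matD(1)[OF pd_mat_inv[OF A] iA]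
      pd_matD(1)[OF pd_mat_inv[OF B] iB] by simp
qed

text \<open>The converse is antitonicity applied to the inverses, since inverting twice restores a
  positive definite matrix. This direction is what lets an inversion be undone in the filter
  recursion.\<close>

lemma mat_inv_antimono_iff:
  assumes A: "A \<in> carrier_mat n n" "pd_mat A" and B: "B \<in> carrier_mat n n" "pd_mat B"
  shows "mat_inv B \<succeq>\<^sub>L mat_inv A \<longleftrightarrow> A \<succeq>\<^sub>L B"
  using mat_inv_antimono[OF A B] mat_inv_mat_inv[OF A] mat_inv_mat_inv[OF B]
    mat_inv_antimono[OF pd_inv(1)[OF B] pd_mat_inv[OF B] pd_inv(1)[OF A] pd_mat_inv[OF A]]
  by auto

section \<open>Entries and trace of a positive semidefinite matrix\<close>

lemma quad_form_add_unit_vec: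
  fixes c :: real
  assumes A: "A \<in> carrier_mat n n" and sym: "transpose_mat A = A" and ij: "i < n" "j < n"
  shows "(unit_vec n i + c \<cdot>\<^sub>v unit_vec n j) \<bullet> (A *\<^sub>v (unit_vec n i + c \<cdot>\<^sub>v unit_vec n j))
    = A $$ (i, i) + 2 * c * A $$ (i, j) + c\<^sup>2 * A $$ (j, j)"
proof -
  let ?u = "unit_vec n i :: real vec" and ?w = "unit_vec n j :: real vec"
  have e: "unit_vec n p \<bullet> (A *\<^sub>v unit_vec n q) = A $$ (p, q)" if "p < n" "q < n" for p q
    using that A by simp
  have "A $$ (j, i) = A $$ (i, j)" using sym A ij by (metis carrier_matD index_transpose_mat(1))
  moreover have "A *\<^sub>v (?u + c \<cdot>\<^sub>v ?w) = A *\<^sub>v ?u + c \<cdot>\<^sub>v (A *\<^sub>v ?w)"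
    using A by (simp add: mult_add_distrib_mat_vec[of _ n n] mult_mat_vec)
  moreover have "A *\<^sub>v ?u \<in> carrier_vec n" "A *\<^sub>v ?w \<in> carrier_vec n" using A by auto
  moreover have "(x + c \<cdot>\<^sub>v y) \<bullet> (x' + c \<cdot>\<^sub>v y') = x \<bullet> x' + c * (x \<bullet> y') + (c * (y \<bullet> x') + c * (c * (y \<bullet> y')))"
    if "x \<in> carrier_vec n" "y \<in> carrier_vec n" "x' \<in> carrier_vec n" "y' \<in> carrier_vec n" for x y x' y'
    using that by (simp add: scalar_prod_add_distrib[of _ n] add_scalar_prod_distrib[of _ n] algebra_simps)
  ultimately show ?thesis using e[OF ij(1,1)] e[OF ij] e[OF ij(2,1)] e[OF ij(2,2)]
    by (simp only: unit_vec_carrier) (simp add: power2_eq_square)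
qed

text \<open>The diagonal entries are nonnegative and add up to zero, so each is zero. The form at
  the sum and at the difference of two unit vectors is then plus or minus twice an off-diagonal
  entry, which must vanish too.\<close>

lemma psd_tr_0:
  assumes A: "A \<in> carrier_mat n n" and psd: "psd_mat A" and tr: "tr_mat A = 0"
  shows "A = 0\<^sub>m n n"
proof (rule eq_matI)
  have sym: "transpose_mat A = A" using psd_matD(1)[OF psd A] .
  have ge: "0 \<le> A $$ (i, i) + 2 * c * A $$ (i, j) + c\<^sup>2 * A $$ (j, j)"
    if "i < n" "j < n" for i j c
    using quad_form_add_unit_vec[OF A sym that, of c] psd_matD(2)[OF psd A] by (metis
      add_carrier_vec smult_carrier_vec unit_vec_carrier)
  have "\<forall>i\<in>{..<n}. A $$ (i, i) = 0"
    using tr A ge[of _ _ 0] by (subst sum_nonneg_eq_0_iff[symmetric]) (auto simp: tr_mat_def)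
  then show "A $$ (i, j) = 0\<^sub>m n n $$ (i, j)" if "i < dim_row (0\<^sub>m n n)" "j < dim_col (0\<^sub>m n n)" for i j
    using that ge[of i j 1] ge[of i j "-1"] by auto
qed (use A in auto)

text \<open>The difference is positive semidefinite with trace at most zero. This is how a
  comparison of traces is turned into equality of information matrices.\<close>

lemma loewner_ge_tr_le:
  assumes A: "A \<in> carrier_mat n n" and B: "B \<in> carrier_mat n n"
    and ge: "A \<succeq>\<^sub>L B" and tr: "tr_mat A \<le> tr_mat B"
  shows "A = B"
proof -
  have psd: "psd_mat (A - B)" using ge by (simp add: loewner_ge_def)
  have c: "A - B \<in> carrier_mat n n" using A B by auto
  have "0 \<le> (A - B) $$ (i, i)" if "i < n" for i
  proof -
    have "unit_vec n i \<bullet> ((A - B) *\<^sub>v unit_vec n i) = (A - B) $$ (i, i)"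
      using c that by (simp del: index_minus_mat)
    then show ?thesis using psd_matD(2)[OF psd c unit_vec_carrier, of i] by simp
  qed
  then have "0 \<le> tr_mat (A - B)" using A B by (auto simp: tr_mat_def intro!: sum_nonneg)
  moreover have "tr_mat (A - B) = tr_mat A - tr_mat B"
    using A B by (simp add: tr_mat_def sum_subtractf)
  ultimately have "A - B = 0\<^sub>m n n" using psd_tr_0[OF c psd] tr by simp
  then have "(A - B) $$ (i, j) = 0" if "i < n" "j < n" for i j using that by simp
  then show ?thesis using A B by (intro eq_matI) auto
qed

section \<open>Finite sums of matrices\<close>

lemma mat_sum_carrier [simp]: "mat_sum n p M I \<in> carrier_mat n p"
  by (simp add: mat_sum_def)

lemma quad_form_mat_sum:
  assumes "\<And>i. i \<in> I \<Longrightarrow> M i \<in> carrier_mat n n" "v \<in> carrier_vec n"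
  shows "v \<bullet> (mat_sum n n M I *\<^sub>v v) = (\<Sum>i\<in>I. v \<bullet> (M i *\<^sub>v v))"
proof -
  have "v \<bullet> (mat_sum n n M I *\<^sub>v v) = (\<Sum>p<n. \<Sum>q<n. \<Sum>i\<in>I. v $ p * M i $$ (p, q) * v $ q)"
    unfolding quad_form_sum[OF mat_sum_carrier assms(2)]
    by (intro sum.cong refl) (simp add: mat_sum_def sum_distrib_left sum_distrib_right)
  also have "\<dots> = (\<Sum>p<n. \<Sum>i\<in>I. \<Sum>q<n. v $ p * M i $$ (p, q) * v $ q)"
    by (intro sum.cong refl sum.swap)
  also have "\<dots> = (\<Sum>i\<in>I. \<Sum>p<n. \<Sum>q<n. v $ p * M i $$ (p, q) * v $ q)"
    by (rule sum.swap)
  also have "\<dots> = (\<Sum>i\<in>I. v \<bullet> (M i *\<^sub>v v))"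
    using assms by (intro sum.cong refl quad_form_sum[symmetric]) auto
  finally show ?thesis .
qed

lemma transpose_mat_sum:
  assumes "\<And>i. i \<in> I \<Longrightarrow> M i \<in> carrier_mat n n" "\<And>i. i \<in> I \<Longrightarrow> transpose_mat (M i) = M i"
  shows "transpose_mat (mat_sum n n M I) = mat_sum n n M I"
proof (rule eq_matI)
  have "M i $$ (q, p) = M i $$ (p, q)" if "i \<in> I" "p < n" "q < n" for i p q
    using assms[OF that(1)] that by (metis carrier_matD index_transpose_mat(1))
  then show "transpose_mat (mat_sum n n M I) $$ (p, q) = mat_sum n n M I $$ (p, q)"
    if "p < dim_row (mat_sum n n M I)" "q < dim_col (mat_sum n n M I)" for p q
    using that by (auto simp: mat_sum_def intro!: sum.cong)
qed (simp_all add: mat_sum_def)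

lemma psd_mat_sum:
  assumes "\<And>i. i \<in> I \<Longrightarrow> M i \<in> carrier_mat n n" "\<And>i. i \<in> I \<Longrightarrow> psd_mat (M i)"
  shows "psd_mat (mat_sum n n M I)"
  using assms psd_matD(1)
  by (intro psd_matI[of _ n] transpose_mat_sum)
    (auto simp: quad_form_mat_sum intro!: sum_nonneg psd_matD(2)[of _ n])

text \<open>The difference of the sums is the sum of the positive semidefinite differences.\<close>

lemma mat_sum_loewner_ge:
  assumes "\<And>i. i \<in> I \<Longrightarrow> A i \<in> carrier_mat n n" "\<And>i. i \<in> I \<Longrightarrow> B i \<in> carrier_mat n n"
    and "\<And>i. i \<in> I \<Longrightarrow> A i \<succeq>\<^sub>L B i"
  shows "mat_sum n n A I \<succeq>\<^sub>L mat_sum n n B I"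
proof -
  have "(A i - B i) $$ (p, q) = A i $$ (p, q) - B i $$ (p, q)" if "i \<in> I" "p < n" "q < n" for i p q
    using assms(2)[OF that(1)] that by auto
  then have "mat_sum n n A I - mat_sum n n B I = mat_sum n n (\<lambda>i. A i - B i) I"
    by (intro eq_matI) (auto simp: mat_sum_def simp flip: sum_subtractf)
  moreover have "psd_mat (mat_sum n n (\<lambda>i. A i - B i) I)"
    using assms by (intro psd_mat_sum) (auto simp: loewner_ge_def minus_carrier_mat)
  ultimately show ?thesis by (simp add: loewner_ge_def mat_sum_def)
qed

lemma tr_mat_sum:
  assumes "\<And>i. i \<in> I \<Longrightarrow> M i \<in> carrier_mat n n"
  shows "tr_mat (mat_sum n n M I) = (\<Sum>i\<in>I. tr_mat (M i))"
proof -
  have "tr_mat (mat_sum n n M I) = (\<Sum>p<n. \<Sum>i\<in>I. M i $$ (p, p))"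
    by (simp add: tr_mat_def mat_sum_def)
  also have "\<dots> = (\<Sum>i\<in>I. \<Sum>p<n. M i $$ (p, p))" by (rule sum.swap)
  also have "\<dots> = (\<Sum>i\<in>I. tr_mat (M i))"
    using assms by (intro sum.cong refl) (auto simp: tr_mat_def)
  finally show ?thesis .
qed

section \<open>Block matrices\<close>

lemma blk_offset_Suc: "blk_offset d (Suc i) = blk_offset d i + d i"
  by (simp add: blk_offset_def)

text \<open>The blocks partition the flat indices into consecutive intervals. Scalar products over
  flat indices thereby become double sums over a block and a position in it.\<close>

lemma sum_blk_offset:
  "(\<Sum>p<blk_offset d a. f p) = (\<Sum>i<a. \<Sum>x<d i. f (blk_offset d i + x) :: 'a :: comm_monoid_add)"
proof (induction a)
  case (Suc a)
  have "(\<Sum>p<m + n. f p) = (\<Sum>p<m. f p) + (\<Sum>x<n. f (m + x))" for m n :: nat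
    by (induction n) (simp_all add: add.assoc)
  with Suc show ?case by (simp add: blk_offset_Suc)
qed (simp add: blk_offset_def)

lemma blk_offset_cases:
  assumes "p < blk_offset d a"
  obtains i x where "i < a" "x < d i" "p = blk_offset d i + x"
proof -
  have "\<exists>i x. i < a \<and> x < d i \<and> p = blk_offset d i + x" using assms
  proof (induction a)
    case (Suc a)
    show ?case
    proof (cases "p < blk_offset d a")
      case False
      then have "p - blk_offset d a < d a" "p = blk_offset d a + (p - blk_offset d a)"
        using Suc.prems by (auto simp: blk_offset_Suc)
      then show ?thesis by blast
    qed (use Suc.IH less_Suc_eq in blast)
  qed (simp add: blk_offset_def)
  then show ?thesis using that by blast
qed

lemma block_mat_carrier [simp]:
  "block_mat a dr b dc B \<in> carrier_mat (blk_offset dr a) (blk_offset dc b)"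
  by (simp add: block_mat_def)

text \<open>Extensionality in block coordinates: products and transposes can be checked block by
  block, without computing \<open>blk_of\<close> or subtracting offsets.\<close>

lemma eq_block_matI:
  assumes "A \<in> carrier_mat (blk_offset dr a) (blk_offset dc b)"
    and "\<And>i s x y. i < a \<Longrightarrow> s < b \<Longrightarrow> x < dr i \<Longrightarrow> y < dc s \<Longrightarrow>
      A $$ (blk_offset dr i + x, blk_offset dc s + y) = B i s $$ (x, y)"
  shows "A = block_mat a dr b dc B"
proof (rule eq_matI)
  fix p q assume "p < dim_row (block_mat a dr b dc B)" "q < dim_col (block_mat a dr b dc B)"
  then have "p < blk_offset dr a" "q < blk_offset dc b" by (simp_all add: block_mat_def)
  then show "A $$ (p, q) = block_mat a dr b dc B $$ (p, q)"
    by (elim blk_offset_cases) (simp add: assms(2) block_mat_index)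
qed (use assms(1) in \<open>auto simp: block_mat_def\<close>)

lemma block_mat_cong:
  assumes "\<And>i s. i < a \<Longrightarrow> s < b \<Longrightarrow> B i s = C i s"
  shows "block_mat a dr b dc B = block_mat a dr b dc C"
  by (rule eq_block_matI) (simp_all add: block_mat_index assms)

lemma mult_mat_index:
  assumes "A \<in> carrier_mat m n" "B \<in> carrier_mat n p" "i < m" "j < p"
  shows "(A * B) $$ (i, j) = (\<Sum>l<n. A $$ (i, l) * B $$ (l, j))"
  using assms by (simp add: scalar_prod_def atLeast0LessThan)

text \<open>The shape of the selected noise covariance when the sensors are uncorrelated. Products,
  transposes and generalized inverses of such matrices can be taken blockwise.\<close>

definition block_diag :: "nat \<Rightarrow> (nat \<Rightarrow> nat) \<Rightarrow> (nat \<Rightarrow> real mat) \<Rightarrow> real mat" where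
  "block_diag a d D = block_mat a d a d (\<lambda>i s. if i = s then D i else 0\<^sub>m (d i) (d s))"

lemma block_diag_carrier [simp]:
  "block_diag a d D \<in> carrier_mat (blk_offset d a) (blk_offset d a)"
  by (simp add: block_diag_def)

lemma block_diag_mult_block_mat:
  assumes "\<And>i. i < a \<Longrightarrow> D i \<in> carrier_mat (d i) (d i)"
    and "\<And>i s. i < a \<Longrightarrow> s < b \<Longrightarrow> B i s \<in> carrier_mat (d i) (dc s)"
  shows "block_diag a d D * block_mat a d b dc B = block_mat a d b dc (\<lambda>i s. D i * B i s)"
proof (rule eq_block_matI)
  fix i s x y assume *: "i < a" "s < b" "x < d i" "y < dc s"
  have "(block_diag a d D * block_mat a d b dc B) $$ (blk_offset d i + x, blk_offset dc s + y) =
     (\<Sum>l<a. \<Sum>z<d l. block_diag a d D $$ (blk_offset d i + x, blk_offset d l + z) *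
        block_mat a d b dc B $$ (blk_offset d l + z, blk_offset dc s + y))"
    using * by (simp add: mult_mat_index[OF block_diag_carrier block_mat_carrier]
        blk_offset_less sum_blk_offset)
  \<comment> \<open>In block row \<open>i\<close> of the left factor only the block
    \<open>l = i\<close> is nonzero.\<close>
  also have "\<dots> = (\<Sum>l<a. if l = i then (\<Sum>z<d i. D i $$ (x, z) * B i s $$ (z, y)) else 0)"
    using * by (intro sum.cong refl) (auto simp: block_diag_def block_mat_index)
  also have "\<dots> = (D i * B i s) $$ (x, y)"
    using * mult_mat_index[OF assms(1)[of i] assms(2)[of i s] *(3,4)] by simp
  finally show "(block_diag a d D * block_mat a d b dc B) $$ (blk_offset d i + x, blk_offset dc s + y)
    = (D i * B i s) $$ (x, y)" .
qed (rule mult_carrier_mat[OF block_diag_carrier block_mat_carrier])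

lemma block_diag_mult:
  assumes "\<And>i. i < a \<Longrightarrow> D i \<in> carrier_mat (d i) (d i)"
    and "\<And>i. i < a \<Longrightarrow> E i \<in> carrier_mat (d i) (d i)"
  shows "block_diag a d D * block_diag a d E = block_diag a d (\<lambda>i. D i * E i)"
proof -
  have "block_diag a d D * block_diag a d E =
      block_mat a d a d (\<lambda>i s. D i * (if i = s then E i else 0\<^sub>m (d i) (d s)))"
    unfolding block_diag_def[of a d E] using assms by (intro block_diag_mult_block_mat) auto
  also have "\<dots> = block_diag a d (\<lambda>i. D i * E i)"
    unfolding block_diag_def using assms(1)
    by (intro block_mat_cong) (auto simp: right_mult_zero_mat)
  finally show ?thesis .
qed

lemma transpose_block_diag:
  assumes "\<And>i. i < a \<Longrightarrow> D i \<in> carrier_mat (d i) (d i)"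
  shows "transpose_mat (block_diag a d D) = block_diag a d (\<lambda>i. transpose_mat (D i))"
  unfolding block_diag_def[of a d "\<lambda>i. transpose_mat (D i)"]
proof (rule eq_block_matI)
  fix i s x y assume *: "i < a" "s < a" "x < d i" "y < d s"
  have "transpose_mat (block_diag a d D) $$ (blk_offset d i + x, blk_offset d s + y)
      = block_diag a d D $$ (blk_offset d s + y, blk_offset d i + x)"
    using * carrier_matD[OF block_diag_carrier[of a d D]] by (simp add: blk_offset_less)
  also have "\<dots> = (if i = s then transpose_mat (D i) else 0\<^sub>m (d i) (d s)) $$ (x, y)"
    using * assms[of i] by (auto simp: block_diag_def block_mat_index)
  finally show "transpose_mat (block_diag a d D) $$ (blk_offset d i + x, blk_offset d s + y) =
      (if i = s then transpose_mat (D i) else 0\<^sub>m (d i) (d s)) $$ (x, y)" .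
qed simp

lemma block_diag_cong:
  "(\<And>i. i < a \<Longrightarrow> D i = E i) \<Longrightarrow> block_diag a d D = block_diag a d E"
  unfolding block_diag_def by (rule block_mat_cong) auto

text \<open>The Penrose equations involve only products and transposes, and
  \<open>block_diag\<close> commutes with both, so they hold because they hold in each
  block.\<close>

lemma is_pinv_block_diag:
  assumes A: "\<And>i. i < a \<Longrightarrow> A i \<in> carrier_mat (d i) (d i)"
    and pinv: "\<And>i. i < a \<Longrightarrow> is_pinv (A i) (Y i)"
  shows "is_pinv (block_diag a d A) (block_diag a d Y)"
proof -
  have Y: "Y i \<in> carrier_mat (d i) (d i)" if "i < a" for i
    using A[OF that] pinv[OF that] by (auto simp: is_pinv_def)
  note AY = mult_carrier_mat[OF A Y] mult_carrier_mat[OF Y A]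
  show ?thesis
    using pinv carrier_matD[OF block_diag_carrier[of a d A]] unfolding is_pinv_def
    by (simp add: A Y AY block_diag_mult transpose_block_diag cong: block_diag_cong)
qed

lemma block_col_gram:
  assumes "\<And>i. i < a \<Longrightarrow> C i \<in> carrier_mat (d i) r" "\<And>i. i < a \<Longrightarrow> E i \<in> carrier_mat (d i) r"
  shows "transpose_mat (block_mat a d 1 (\<lambda>_. r) (\<lambda>i _. C i)) * block_mat a d 1 (\<lambda>_. r) (\<lambda>i _. E i) =
    mat_sum r r (\<lambda>i. transpose_mat (C i) * E i) {..<a}" (is "transpose_mat ?C * ?E = _")
proof (rule eq_matI)
  have c: "?C \<in> carrier_mat (blk_offset d a) r" "?E \<in> carrier_mat (blk_offset d a) r"
    using block_mat_carrier[of a d 1 "\<lambda>_. r"] by (auto simp: blk_offset_def)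
  fix x y assume "x < dim_row (mat_sum r r (\<lambda>i. transpose_mat (C i) * E i) {..<a})"
    and "y < dim_col (mat_sum r r (\<lambda>i. transpose_mat (C i) * E i) {..<a})"
  then have xy: "x < r" "y < r" by (simp_all add: mat_sum_def)
  \<comment> \<open>The single block column starts at offset 0, so the flat column index is already
    the index inside the block.\<close>
  have ix: "block_mat a d 1 (\<lambda>_. r) (\<lambda>i _. B i) $$ (blk_offset d l + z, w) = B l $$ (z, w)"
    if "l < a" "z < d l" "w < r" for B l z w
    using block_mat_index[of l a 0 1 z d w "\<lambda>_. r" "\<lambda>i _. B i"] that by (simp add: blk_offset_def)
  have "(transpose_mat ?C * ?E) $$ (x, y) = (\<Sum>p<blk_offset d a. ?C $$ (p, x) * ?E $$ (p, y))"
    using c xy mult_mat_index[of "transpose_mat ?C" r "blk_offset d a" ?E r x y] by simp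
  also have "\<dots> = (\<Sum>l<a. \<Sum>z<d l. C l $$ (z, x) * E l $$ (z, y))"
    unfolding sum_blk_offset using xy by (intro sum.cong refl) (simp add: ix del: One_nat_def)
  also have "\<dots> = (\<Sum>l<a. (transpose_mat (C l) * E l) $$ (x, y))"
  proof (intro sum.cong refl)
    fix l assume "l \<in> {..<a}"
    then show "(\<Sum>z<d l. C l $$ (z, x) * E l $$ (z, y)) = (transpose_mat (C l) * E l) $$ (x, y)"
      using assms[of l] xy mult_mat_index[of "transpose_mat (C l)" r "d l" "E l" r x y] by simp
  qed
  finally show "(transpose_mat ?C * ?E) $$ (x, y) =
      mat_sum r r (\<lambda>i. transpose_mat (C i) * E i) {..<a} $$ (x, y)"
    using xy by (simp add: mat_sum_def)
qed (simp_all add: mat_sum_def block_mat_def blk_offset_def)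

text \<open>Extending a vector by zero outside block \<open>i\<close> makes the form of the whole
  matrix equal to the form of that block. It supplies invertibility of each sensor's own noise
  covariance.\<close>

lemma pd_diagonal_block:
  assumes pd: "pd_mat (block_mat a d a d B)" and i: "i < a"
    and Bi: "B i i \<in> carrier_mat (d i) (d i)"
  shows "pd_mat (B i i)"
proof (rule pd_matI[OF Bi])
  let ?M = "block_mat a d a d B"
  have M: "?M \<in> carrier_mat (blk_offset d a) (blk_offset d a)" by simp
  note entry = block_mat_index[of i a i a _ d _ d B, OF i i]
  show "transpose_mat (B i i) = B i i"
  proof (rule eq_matI)
    fix x y assume "x < dim_row (B i i)" "y < dim_col (B i i)"
    then have xy: "x < d i" "y < d i" using Bi by auto
    have "?M $$ (blk_offset d i + y, blk_offset d i + x) = ?M $$ (blk_offset d i + x, blk_offset d i + y)"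
      using pd_matD(1)[OF pd M] xy i M by (metis blk_offset_less carrier_matD index_transpose_mat(1))
    then show "transpose_mat (B i i) $$ (x, y) = B i i $$ (x, y)"
      using xy Bi by (simp add: entry)
  qed (use Bi in auto)
  fix u :: "real vec" assume u: "u \<in> carrier_vec (d i)" "u \<noteq> 0\<^sub>v (d i)"
  \<comment> \<open>\<open>v\<close> is \<open>u\<close> placed in block \<open>i\<close> and zero
    in all other blocks.\<close>
  define v where "v = vec (blk_offset d a)
    (\<lambda>p. if blk_of d p = i then u $ (p - blk_offset d i) else 0)"
  have v: "v \<in> carrier_vec (blk_offset d a)" by (simp add: v_def)
  have vx: "v $ (blk_offset d l + x) = (if l = i then u $ x else 0)" if "l < a" "x < d l" for l x
    using that by (auto simp: v_def blk_of_offset blk_offset_less)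
  obtain x where x: "x < d i" "u $ x \<noteq> 0"
    using u by (metis carrier_vecD eq_vecI index_zero_vec)
  then have "v \<noteq> 0\<^sub>v (blk_offset d a)"
    using vx[OF i x(1)] blk_offset_less[of x d i a] i by auto
  with pd_matD(2)[OF pd M v] have "0 < v \<bullet> (?M *\<^sub>v v)" by blast
  \<comment> \<open>Rows of other blocks contribute nothing because \<open>v\<close> vanishes there;
    in a row of block \<open>i\<close> only the columns of block \<open>i\<close> survive.\<close>
  have inner: "(\<Sum>s<a. \<Sum>y<d s. v $ (blk_offset d l + x) *
      ?M $$ (blk_offset d l + x, blk_offset d s + y) * v $ (blk_offset d s + y)) =
      (if l = i then \<Sum>y<d i. u $ x * B i i $$ (x, y) * u $ y else 0)" if l: "l < a" "x < d l" for l x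
  proof (cases "l = i")
    case True
    then have "(\<Sum>y<d s. v $ (blk_offset d l + x) *
        ?M $$ (blk_offset d l + x, blk_offset d s + y) * v $ (blk_offset d s + y)) =
        (if s = i then \<Sum>y<d i. u $ x * B i i $$ (x, y) * u $ y else 0)" if "s < a" for s
      using l that by (cases "s = i") (simp_all add: vx block_mat_index)
    then show ?thesis using True i by simp
  qed (use l in \<open>simp add: vx\<close>)
  have outer: "(\<Sum>x<d l. if l = i then f x else 0) = (if l = i then sum f {..<d i} else 0)"
    for l and f :: "nat \<Rightarrow> real" by auto
  note \<open>0 < v \<bullet> (?M *\<^sub>v v)\<close>
  also have "v \<bullet> (?M *\<^sub>v v) = (\<Sum>l<a. \<Sum>x<d l. \<Sum>s<a. \<Sum>y<d s.
      v $ (blk_offset d l + x) * ?M $$ (blk_offset d l + x, blk_offset d s + y) * v $ (blk_offset d s + y))"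
    unfolding quad_form_sum[OF M v] sum_blk_offset ..
  also have "\<dots> = (\<Sum>l<a. if l = i then \<Sum>x<d i. \<Sum>y<d i. u $ x * B i i $$ (x, y) * u $ y else 0)"
    by (intro sum.cong refl) (simp add: inner outer)
  also have "\<dots> = u \<bullet> (B i i *\<^sub>v u)"
    using i by (simp add: quad_form_sum[OF Bi u(1)])
  finally show "0 < u \<bullet> (B i i *\<^sub>v u)" .
qed

section \<open>The information matrix\<close>

text \<open>For \<open>c = 1\<close> the ordinary inverse satisfies the Penrose equations; for
  \<open>c = 0\<close> the zero matrix is its own generalized inverse. The second case is an
  unselected sensor.\<close>

lemma is_pinv_smult_01:
  assumes A: "A \<in> carrier_mat n n" and pd: "pd_mat A" and c: "c \<in> {0, 1}"
  shows "is_pinv (c \<cdot>\<^sub>m A) (c \<cdot>\<^sub>m mat_inv A)"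
proof (cases "c = 0")
  case True
  have z: "0 \<cdot>\<^sub>m B = 0\<^sub>m n n" if "B \<in> carrier_mat n n" for B :: "real mat"
    using that by (intro eq_matI) auto
  show ?thesis using A pd_inv(1)[OF A pd] unfolding True by (simp add: z is_pinv_def)
next
  case False
  have o: "1 \<cdot>\<^sub>m B = B" for B :: "real mat" by (intro eq_matI) auto
  show ?thesis using A pd_inv[OF A pd] False c by (simp add: o is_pinv_def)
qed

text \<open>The three factors \<open>c\<close> collapse to one because 0 and 1 are
  idempotent.\<close>

lemma smult_01_gram:
  fixes G :: "real mat"
  assumes G: "G \<in> carrier_mat n n" and H: "H \<in> carrier_mat n r" and c: "c \<in> {0, 1}"
  shows "transpose_mat (c \<cdot>\<^sub>m H) * ((c \<cdot>\<^sub>m G) * (c \<cdot>\<^sub>m H)) = c \<cdot>\<^sub>m (transpose_mat H * G * H)"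
proof (cases "c = 0")
  case True
  have z: "0 \<cdot>\<^sub>m B = 0\<^sub>m (dim_row B) (dim_col B)" for B :: "real mat"
    by (intro eq_matI) auto
  show ?thesis using G H unfolding True by (simp add: z)
next
  case False
  have o: "1 \<cdot>\<^sub>m B = B" for B :: "real mat" by (intro eq_matI) auto
  show ?thesis using G H False c by (simp add: o assoc_mult_mat[of _ r n _ n _ r])
qed

text \<open>Without correlation the selected noise covariance is block diagonal, hence so is its
  generalized inverse, and the information becomes additive over the selected sensors. Its trace is
  then linear in the decision variables.\<close>

lemma info_mat_eq:
  assumes H: "\<And>i. i < L \<Longrightarrow> H j i \<in> carrier_mat (d i) r"
    and R: "\<And>i. i < L \<Longrightarrow> R j i i \<in> carrier_mat (d i) (d i)"
    and uncorrelated: "\<And>i s. i < L \<Longrightarrow> s < L \<Longrightarrow> i \<noteq> s \<Longrightarrow> R j i s = 0\<^sub>m (d i) (d s)"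
    and pd: "\<And>i. i < L \<Longrightarrow> pd_mat (R j i i)"
    and \<gamma>: "\<And>i. i < L \<Longrightarrow> \<gamma> j i \<in> {0, 1}"
  shows "info_mat r L d H R \<gamma> j = mat_sum r r
    (\<lambda>i. real (\<gamma> j i) \<cdot>\<^sub>m (transpose_mat (H j i) * mat_inv (R j i i) * H j i)) {..<L}"
proof -
  let ?c = "\<lambda>i. real (\<gamma> j i)"
  have c: "?c i \<in> {0, 1}" if "i < L" for i using \<gamma>[OF that] by auto
  note inv = pd_inv(1)[OF R pd]
  have "R_sel L d R \<gamma> j = block_diag L d (\<lambda>i. ?c i \<cdot>\<^sub>m R j i i)"
    unfolding R_sel_def block_diag_def
  proof (rule block_mat_cong)
    fix i s assume ij: "i < L" "s < L"
    \<comment> \<open>On the diagonal the block carries the square of the decision variable, which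
      is Boolean; off the diagonal the block is zero anyway.\<close>
    have "?c i * ?c i = ?c i" using c[OF ij(1)] by auto
    then show "(?c i * ?c s) \<cdot>\<^sub>m R j i s = (if i = s then ?c i \<cdot>\<^sub>m R j i i else 0\<^sub>m (d i) (d s))"
      using uncorrelated[OF ij] by auto
  qed
  moreover have "is_pinv (block_diag L d (\<lambda>i. ?c i \<cdot>\<^sub>m R j i i))
      (block_diag L d (\<lambda>i. ?c i \<cdot>\<^sub>m mat_inv (R j i i)))"
    using R pd c by (intro is_pinv_block_diag is_pinv_smult_01) auto
  ultimately have pinv: "pinv (R_sel L d R \<gamma> j) = block_diag L d (\<lambda>i. ?c i \<cdot>\<^sub>m mat_inv (R j i i))"
    using pinv_eqI by simp
  have Hs: "H_sel r L d H \<gamma> j = block_mat L d 1 (\<lambda>_. r) (\<lambda>i _. ?c i \<cdot>\<^sub>m H j i)"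
    by (simp add: H_sel_def)
  have Hc: "H_sel r L d H \<gamma> j \<in> carrier_mat (blk_offset d L) r"
    unfolding Hs using block_mat_carrier[of L d 1 "\<lambda>_. r"] by (simp add: blk_offset_def)
  have "info_mat r L d H R \<gamma> j =
      transpose_mat (H_sel r L d H \<gamma> j) * (pinv (R_sel L d R \<gamma> j) * H_sel r L d H \<gamma> j)"
    unfolding info_mat_def pinv using Hc by (intro assoc_mult_mat) auto
  also have "pinv (R_sel L d R \<gamma> j) * H_sel r L d H \<gamma> j =
      block_mat L d 1 (\<lambda>_. r) (\<lambda>i _. (?c i \<cdot>\<^sub>m mat_inv (R j i i)) * (?c i \<cdot>\<^sub>m H j i))"
    unfolding pinv Hs using H inv by (intro block_diag_mult_block_mat) auto
  also have "transpose_mat (H_sel r L d H \<gamma> j) * \<dots> = mat_sum r r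
      (\<lambda>i. transpose_mat (?c i \<cdot>\<^sub>m H j i) * ((?c i \<cdot>\<^sub>m mat_inv (R j i i)) * (?c i \<cdot>\<^sub>m H j i))) {..<L}"
    unfolding Hs using H inv by (intro block_col_gram) (auto intro!: mult_carrier_mat smult_carrier_mat)
  also have "\<dots> = mat_sum r r
      (\<lambda>i. ?c i \<cdot>\<^sub>m (transpose_mat (H j i) * mat_inv (R j i i) * H j i)) {..<L}"
    unfolding mat_sum_def using smult_01_gram[OF inv H c] by (intro cong_mat refl) auto
  finally show ?thesis .
qed

lemma tr_mat_smult: "A \<in> carrier_mat n n \<Longrightarrow> tr_mat (c \<cdot>\<^sub>m A) = c * tr_mat A"
  by (simp add: tr_mat_def sum_distrib_left)

lemma psd_smult:
  assumes "A \<in> carrier_mat n n" "psd_mat A" "0 \<le> c"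
  shows "psd_mat (c \<cdot>\<^sub>m A)"
proof (rule psd_matI)
  have "transpose_mat (c \<cdot>\<^sub>m A) = c \<cdot>\<^sub>m transpose_mat A" by (intro eq_matI) auto
  then show "transpose_mat (c \<cdot>\<^sub>m A) = c \<cdot>\<^sub>m A" using psd_matD(1)[OF assms(2,1)] by simp
  show "0 \<le> v \<bullet> ((c \<cdot>\<^sub>m A) *\<^sub>v v)" if v: "v \<in> carrier_vec n" for v
  proof -
    have "v \<bullet> ((c \<cdot>\<^sub>m A) *\<^sub>v v) = c * (v \<bullet> (A *\<^sub>v v))"
      using assms v by (simp add: quad_form_sum[of _ n] sum_distrib_left mult_ac)
    then show ?thesis using psd_matD(2)[OF assms(2,1) v] assms(3) by simp
  qed
qed (use assms in auto)

section \<open>The filter recursion\<close>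

text \<open>The first summand is a congruence of \<open>P\<close> by the transpose of
  \<open>Fj\<close>, hence positive semidefinite; definiteness comes from \<open>Qj\<close>. So the
  prediction is invertible even for singular \<open>P\<close>.\<close>

lemma pred_cov_pd:
  assumes "Fj \<in> carrier_mat n n" "Qj \<in> carrier_mat n n" "pd_mat Qj" "P \<in> carrier_mat n n" "psd_mat P"
  shows "pred_cov Fj Qj P \<in> carrier_mat n n" "pd_mat (pred_cov Fj Qj P)"
  using assms psd_congruence[of P n "transpose_mat Fj" n]
  by (auto simp: pred_cov_def intro!: pd_add[of _ n])

lemma loewner_add_left_iff:
  assumes "A \<in> carrier_mat n n" "B \<in> carrier_mat n n" "C \<in> carrier_mat n n"
  shows "C + A \<succeq>\<^sub>L C + B \<longleftrightarrow> A \<succeq>\<^sub>L B"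
proof -
  have "(C + A) - (C + B) = A - B" using assms by (intro eq_matI) auto
  then show ?thesis using assms by (simp add: loewner_ge_def)
qed

lemma loewner_add_right_iff:
  assumes "A \<in> carrier_mat n n" "B \<in> carrier_mat n n" "C \<in> carrier_mat n n"
  shows "A + C \<succeq>\<^sub>L B + C \<longleftrightarrow> A \<succeq>\<^sub>L B"
  using loewner_add_left_iff[OF assms] assms by (simp add: comm_add_mat[of _ n n])

text \<open>Since \<open>F\<close> is invertible, every \<open>v\<close> has the form
  \<open>F' w\<close>, and the congruent forms at \<open>w\<close> are the original forms at
  \<open>v\<close>.\<close>

lemma loewner_congruence_cancel:
  fixes F :: "real mat"
  assumes F: "F \<in> carrier_mat n n" "invertible_mat F"
    and A: "A \<in> carrier_mat n n" "psd_mat A" and B: "B \<in> carrier_mat n n" "psd_mat B"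
    and ge: "F * A * transpose_mat F \<succeq>\<^sub>L F * B * transpose_mat F"
  shows "A \<succeq>\<^sub>L B"
proof -
  \<comment> \<open>\<open>invertible_mat\<close> yields a \<open>G\<close> of unspecified size; its
    dimensions are read off from the two identity products.\<close>
  obtain G where G: "inverts_mat F G" "inverts_mat G F" using F by (auto simp: invertible_mat_def)
  then have "dim_col G = n" using F unfolding inverts_mat_def
    by (metis carrier_matD(1) index_mult_mat(3) index_one_mat(3))
  moreover have "dim_row G = n" using F G unfolding inverts_mat_def
    by (metis carrier_matD(2) index_mult_mat(3) index_one_mat(3))
  ultimately have Gc: "G \<in> carrier_mat n n" and GF: "G * F = 1\<^sub>m n"
    using G by (auto simp: inverts_mat_def)
  have Ft: "transpose_mat F \<in> carrier_mat n n" using F by simp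
  note cong = quad_form_congruence[OF _ Ft, simplified]
  have "v \<bullet> (B *\<^sub>v v) \<le> v \<bullet> (A *\<^sub>v v)" if v: "v \<in> carrier_vec n" for v
  proof -
    define w where "w = transpose_mat G *\<^sub>v v"
    have w: "w \<in> carrier_vec n" using Gc v by (auto simp: w_def)
    have "transpose_mat F *\<^sub>v w = (transpose_mat F * transpose_mat G) *\<^sub>v v"
      unfolding w_def using F Gc v by (simp add: assoc_mult_mat_vec[of _ n n])
    also have "transpose_mat F * transpose_mat G = 1\<^sub>m n"
      using transpose_mult[OF Gc F(1)] GF by simp
    finally have Fw: "transpose_mat F *\<^sub>v w = v" using v by simp
    have c: "F * M * transpose_mat F \<in> carrier_mat n n" if "M \<in> carrier_mat n n" for M
      using F that by auto
    have "psd_mat (F * A * transpose_mat F - F * B * transpose_mat F)"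
      using ge by (simp add: loewner_ge_def)
    from psd_matD(2)[OF this minus_carrier_mat[OF c[OF B(1)]] w]
    have "w \<bullet> (F * B * transpose_mat F *\<^sub>v w) \<le> w \<bullet> (F * A * transpose_mat F *\<^sub>v w)"
      using quad_form_minus[OF c[OF A(1)] c[OF B(1)] w] c[OF A(1)] c[OF B(1)] by simp
    then show ?thesis using cong[OF A(1) w] cong[OF B(1) w] Fw by simp
  qed
  then show ?thesis using loewner_iff[OF A(1) B(1)] psd_matD(1)[OF A(2,1)] psd_matD(1)[OF B(2,1)] by blast
qed

text \<open>One step of the recursion with the information matrix as a free argument, so that it can
  be varied independently of the previous covariance.\<close>

definition filter_step :: "real mat \<Rightarrow> real mat \<Rightarrow> real mat \<Rightarrow> real mat \<Rightarrow> real mat" where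
  "filter_step Fj Qj P C = mat_inv (mat_inv (pred_cov Fj Qj P) + C)"

context
  fixes n :: nat and Fj Qj :: "real mat"
  assumes Fj: "Fj \<in> carrier_mat n n" and Qj: "Qj \<in> carrier_mat n n" "pd_mat Qj"
begin

lemma information_pd:
  assumes "P \<in> carrier_mat n n" "psd_mat P" "C \<in> carrier_mat n n" "psd_mat C"
  shows "mat_inv (pred_cov Fj Qj P) + C \<in> carrier_mat n n" "pd_mat (mat_inv (pred_cov Fj Qj P) + C)"
proof -
  note p = pred_cov_pd[OF Fj Qj assms(1,2)]
  note i = pd_inv(1)[OF p] pd_mat_inv[OF p]
  show "mat_inv (pred_cov Fj Qj P) + C \<in> carrier_mat n n" using assms i by auto
  show "pd_mat (mat_inv (pred_cov Fj Qj P) + C)"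
    using pd_add[OF assms(3) i(1) assms(4) i(2)] comm_add_mat[OF assms(3) i(1)] by simp
qed

lemma filter_step_pd:
  assumes "P \<in> carrier_mat n n" "psd_mat P" "C \<in> carrier_mat n n" "psd_mat C"
  shows "filter_step Fj Qj P C \<in> carrier_mat n n" "pd_mat (filter_step Fj Qj P C)"
  unfolding filter_step_def using pd_inv(1) pd_mat_inv information_pd[OF assms] by auto

text \<open>The outer inversion reverses the order, and the information from the common prediction
  cancels. A smaller covariance thus means a larger information matrix.\<close>

lemma filter_step_ge_info:
  assumes P: "P \<in> carrier_mat n n" "psd_mat P"
    and C: "C \<in> carrier_mat n n" "psd_mat C" and C': "C' \<in> carrier_mat n n" "psd_mat C'"
    and ge: "filter_step Fj Qj P C \<succeq>\<^sub>L filter_step Fj Qj P C'"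
  shows "C' \<succeq>\<^sub>L C"
  using ge mat_inv_antimono_iff[OF information_pd[OF P C'] information_pd[OF P C]]
    loewner_add_left_iff[OF C'(1) C(1) pd_inv(1)[OF pred_cov_pd[OF Fj Qj P]]]
  by (simp add: filter_step_def)

text \<open>The layers of the step are peeled off from the outside: the inversion, the common
  \<open>C\<close>, the second inversion, the common \<open>Qj\<close>, and finally the congruence
  by \<open>Fj\<close>. The two inversions together preserve the direction of the order.\<close>

lemma filter_step_ge_prev:
  assumes inv: "invertible_mat Fj" and P: "P \<in> carrier_mat n n" "psd_mat P"
    and P': "P' \<in> carrier_mat n n" "psd_mat P'" and C: "C \<in> carrier_mat n n" "psd_mat C"
    and ge: "filter_step Fj Qj P C \<succeq>\<^sub>L filter_step Fj Qj P' C"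
  shows "P \<succeq>\<^sub>L P'"
proof (rule loewner_congruence_cancel[OF Fj inv P P'])
  note p = pred_cov_pd[OF Fj Qj P] and p' = pred_cov_pd[OF Fj Qj P']
  have "mat_inv (pred_cov Fj Qj P') \<succeq>\<^sub>L mat_inv (pred_cov Fj Qj P)"
    using ge mat_inv_antimono_iff[OF information_pd[OF P' C] information_pd[OF P C]]
      loewner_add_right_iff[OF pd_inv(1)[OF p'] pd_inv(1)[OF p] C(1)]
    by (simp add: filter_step_def)
  then have "pred_cov Fj Qj P \<succeq>\<^sub>L pred_cov Fj Qj P'"
    using mat_inv_antimono_iff[OF p p'] by simp
  then show "Fj * P * transpose_mat Fj \<succeq>\<^sub>L Fj * P' * transpose_mat Fj"
    unfolding pred_cov_def using Fj Qj P P' by (subst (asm) loewner_add_right_iff) auto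
qed

end

lemma err_cov_Suc: "err_cov r L d F Q H R k P0 \<gamma> (Suc n) = filter_step (F (k + n)) (Q (k + n))
    (err_cov r L d F Q H R k P0 \<gamma> n) (info_mat r L d H R \<gamma> (k + Suc n))"
  by (simp add: filter_step_def)

lemma info_mat_cong: "\<gamma> j = \<gamma>' j \<Longrightarrow> info_mat r L d H R \<gamma> j = info_mat r L d H R \<gamma>' j"
  by (simp add: info_mat_def H_sel_def R_sel_def)

text \<open>Selections enter the recursion only through their information matrices. Equality of
  these suffices, so that selections differing as Boolean vectors can still be identified.\<close>

lemma err_cov_cong:
  assumes "\<And>i. i \<in> {1..n} \<Longrightarrow> info_mat r L d H R \<gamma> (k + i) = info_mat r L d H R \<gamma>' (k + i)"
  shows "err_cov r L d F Q H R k P0 \<gamma> n = err_cov r L d F Q H R k P0 \<gamma>' n"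
  using assms
proof (induction n)
  case (Suc n)
  have "info_mat r L d H R \<gamma> (k + Suc n) = info_mat r L d H R \<gamma>' (k + Suc n)"
    by (rule Suc.prems) simp
  moreover have "err_cov r L d F Q H R k P0 \<gamma> n = err_cov r L d F Q H R k P0 \<gamma>' n"
    by (rule Suc.IH) (simp add: Suc.prems)
  ultimately show ?case by (simp only: err_cov_Suc)
qed simp

section \<open>Selecting the largest values\<close>

lemma sum_indicator_prefix:
  fixes m L :: nat
  assumes "m \<le> L"
  shows "(\<Sum>p<L. if p < m then 1 else 0) = (of_nat m :: 'a :: semiring_1)"
proof -
  have "(\<Sum>p<L. if p < m then 1 else 0 :: 'a) = (\<Sum>p\<in>{..<L} \<inter> {p. p < m}. 1)"
    by (subst sum.inter_restrict) (auto intro!: sum.cong)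
  also have "{..<L} \<inter> {p. p < m} = {..<m}" using assms by auto
  finally show ?thesis by simp
qed

text \<open>Compare each \<open>b p\<close> with the threshold \<open>t\<close> that separates the first \<open>m\<close> values from the rest.\<close>

lemma sum_top_le:
  fixes b :: "nat \<Rightarrow> real" and g :: "nat \<Rightarrow> nat"
  assumes desc: "\<And>p q. p \<le> q \<Longrightarrow> q < L \<Longrightarrow> b q \<le> b p" and m: "m \<le> L"
    and g: "\<And>p. p < L \<Longrightarrow> g p \<in> {0, 1}" "(\<Sum>p<L. g p) = m"
  shows "(\<Sum>p<L. real (g p) * b p) \<le> (\<Sum>p<L. real (if p < m then 1 else 0) * b p)"
proof -
  \<comment> \<open>For \<open>m = 0\<close> truncated subtraction gives \<open>t = b 0\<close>,
    which still bounds every \<open>b p\<close> from above.\<close>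
  define t where "t = b (m - 1)"
  let ?s = "\<lambda>p. real (if p < m then 1 else 0)"
  have s: "(\<Sum>p<L. ?s p) = real m"
    using sum_indicator_prefix[OF m, where 'a = nat] by (simp flip: of_nat_sum)
  \<comment> \<open>Each product is nonnegative: before position \<open>m\<close> both factors are
    at least zero, from there on both are at most zero.\<close>
  have "0 \<le> (\<Sum>p<L. (?s p - real (g p)) * (b p - t))"
  proof (rule sum_nonneg)
    fix p assume p: "p \<in> {..<L}"
    have "g p = 0 \<or> g p = 1" using g(1)[of p] p by auto
    moreover have "t \<le> b p" if "p < m" using desc[of p "m - 1"] that m by (auto simp: t_def)
    moreover have "b p \<le> t" if "\<not> p < m" using desc[of "m - 1" p] that p by (auto simp: t_def)
    ultimately show "0 \<le> (?s p - real (g p)) * (b p - t)" by auto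
  qed
  \<comment> \<open>The terms with \<open>t\<close> cancel in the end because both selections have
    exactly \<open>m\<close> ones.\<close>
  also have "(\<Sum>p<L. (f p - h p) * (b p - t)) = (\<Sum>p<L. f p * b p) - (\<Sum>p<L. h p * b p)
      - t * ((\<Sum>p<L. f p) - (\<Sum>p<L. h p))" for f h :: "nat \<Rightarrow> real"
    by (simp add: left_diff_distrib right_diff_distrib sum_subtractf sum_distrib_left mult.commute[of t])
  also have "(\<Sum>p<L. real (g p)) = real m" using g(2) by (metis of_nat_sum)
  finally show ?thesis using s by simp
qed

section \<open>Optimality of selecting the sensors of largest trace\<close>

theorem theorem4p1:
  fixes k N L r :: nat
    and m d :: "nat \<Rightarrow> nat"
    and F Q :: "nat \<Rightarrow> real mat"
    and H :: "nat \<Rightarrow> nat \<Rightarrow> real mat"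
    and R :: "nat \<Rightarrow> nat \<Rightarrow> nat \<Rightarrow> real mat"
    and P0 :: "real mat"
    and a :: "nat \<Rightarrow> nat \<Rightarrow> real"
    and idx :: "nat \<Rightarrow> nat \<Rightarrow> nat"
    and \<gamma>s :: "nat \<Rightarrow> nat \<Rightarrow> nat"
  defines "P \<equiv> err_cov r L d F Q H R k P0"
    and "info \<equiv> info_mat r L d H R"
    and "X \<equiv> feasible k N L m"
  assumes N: "N \<ge> 1"
    and m: "\<And>n. n \<in> {1..N} \<Longrightarrow> m (k + n) \<le> L"
    and F: "\<And>j. j \<in> {k..<k + N} \<Longrightarrow> F j \<in> carrier_mat r r \<and> invertible_mat (F j)"
    and Q: "\<And>j. j \<in> {k..<k + N} \<Longrightarrow> Q j \<in> carrier_mat r r \<and> pd_mat (Q j)"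
    and H: "\<And>n i. n \<in> {1..N} \<Longrightarrow> i < L \<Longrightarrow> H (k + n) i \<in> carrier_mat (d i) r"
    and R: "\<And>n i s. n \<in> {1..N} \<Longrightarrow> i < L \<Longrightarrow> s < L \<Longrightarrow> R (k + n) i s \<in> carrier_mat (d i) (d s)"
    and R_pd: "\<And>n. n \<in> {1..N} \<Longrightarrow> pd_mat (block_mat L d L d (R (k + n)))"
    and P0: "P0 \<in> carrier_mat r r" "psd_mat P0"
    and uncorrelated: "\<And>n i s. n \<in> {1..N} \<Longrightarrow> i < L \<Longrightarrow> s < L \<Longrightarrow> i \<noteq> s \<Longrightarrow>
      R (k + n) i s = 0\<^sub>m (d i) (d s)"
    and a: "\<And>n i. n \<in> {1..N} \<Longrightarrow> i < L \<Longrightarrow>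
      a (k + n) i = tr_mat (transpose_mat (H (k + n) i) * mat_inv (R (k + n) i i) * H (k + n) i)"
    and idx: "\<And>n. n \<in> {1..N} \<Longrightarrow> bij_betw (idx n) {..<L} {..<L}"
    and idx_desc: "\<And>n p q. n \<in> {1..N} \<Longrightarrow> p \<le> q \<Longrightarrow> q < L \<Longrightarrow>
      a (k + n) (idx n p) \<ge> a (k + n) (idx n q)"
    and scheme: "\<And>n p. n \<in> {1..N} \<Longrightarrow> p < L \<Longrightarrow>
      \<gamma>s (k + n) (idx n p) = (if p < m (k + n) then 1 else 0)"
  shows "((\<exists>\<gamma>. loewner_optimal X (\<lambda>\<gamma>. P \<gamma> N) \<gamma>) \<longrightarrow>
           loewner_optimal X (\<lambda>\<gamma>. P \<gamma> N) \<gamma>s \<and>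
           loewner_optimal X (\<lambda>\<gamma>. mat_sum r r (P \<gamma>) {1..N}) \<gamma>s \<and>
           (\<forall>n\<in>{1..N}. is_arg_max (\<lambda>\<gamma>. tr_mat (info \<gamma> (k + n))) (\<lambda>\<gamma>. \<gamma> \<in> X) \<gamma>s))
       \<and> ((\<nexists>\<gamma>. loewner_optimal X (\<lambda>\<gamma>. P \<gamma> N) \<gamma>) \<longrightarrow>
           (\<forall>n\<in>{1..N}. is_arg_max (\<lambda>\<gamma>. tr_mat (info \<gamma> (k + n))) (\<lambda>\<gamma>. \<gamma> \<in> X) \<gamma>s))"
proof -
  define G where "G = (\<lambda>n i. transpose_mat (H (k + n) i) * mat_inv (R (k + n) i i) * H (k + n) i)"
  have R_diag: "R (k + n) i i \<in> carrier_mat (d i) (d i)" "pd_mat (R (k + n) i i)"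
    if "n \<in> {1..N}" "i < L" for n i
    using R[OF that that(2)] pd_diagonal_block[OF R_pd[OF that(1)] that(2)] by auto
  have G: "G n i \<in> carrier_mat r r" "psd_mat (G n i)" if "n \<in> {1..N}" "i < L" for n i
    using psd_congruence[OF pd_inv(1)[OF R_diag[OF that]] pd_imp_psd[OF pd_mat_inv[OF R_diag[OF that]]]
        H[OF that]] H[OF that] pd_inv(1)[OF R_diag[OF that]]
    by (auto simp: G_def)
  have a_eq: "a (k + n) i = tr_mat (G n i)" if "n \<in> {1..N}" "i < L" for n i
    unfolding G_def by (rule a[OF that])
  have sel01: "\<gamma> (k + n) i \<in> {0, 1}" if "\<gamma> \<in> X" "n \<in> {1..N}" "i < L" for \<gamma> n i
    using that by (auto simp: X_def feasible_def)
  have info_eq: "info \<gamma> (k + n) = mat_sum r r (\<lambda>i. real (\<gamma> (k + n) i) \<cdot>\<^sub>m G n i) {..<L}"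
    if "\<gamma> \<in> X" "n \<in> {1..N}" for \<gamma> n
    unfolding info_def G_def
    using that H R_diag uncorrelated sel01 by (intro info_mat_eq) auto
  have info: "info \<gamma> (k + n) \<in> carrier_mat r r" "psd_mat (info \<gamma> (k + n))"
    if "\<gamma> \<in> X" "n \<in> {1..N}" for \<gamma> n
    unfolding info_eq[OF that] using G[OF that(2)] by (auto intro!: psd_mat_sum psd_smult)
  \<comment> \<open>The sum is reindexed along \<open>idx n\<close>, so that the weights come in
    descending order as \<open>sum_top_le\<close> requires.\<close>
  have tr_info: "tr_mat (info \<gamma> (k + n)) = (\<Sum>p<L. real (\<gamma> (k + n) (idx n p)) * a (k + n) (idx n p))"
    if "\<gamma> \<in> X" "n \<in> {1..N}" for \<gamma> n
  proof -
    have "tr_mat (info \<gamma> (k + n)) = (\<Sum>i<L. tr_mat (real (\<gamma> (k + n) i) \<cdot>\<^sub>m G n i))"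
      unfolding info_eq[OF that] using G[OF that(2)] by (intro tr_mat_sum) auto
    also have "\<dots> = (\<Sum>i<L. real (\<gamma> (k + n) i) * a (k + n) i)"
      using a_eq[OF that(2)] tr_mat_smult[OF G(1)[OF that(2)]]
      by (intro sum.cong refl) simp
    also have "\<dots> = (\<Sum>p<L. real (\<gamma> (k + n) (idx n p)) * a (k + n) (idx n p))"
      by (rule sum.reindex_bij_betw[OF idx[OF that(2)], symmetric])
    finally show ?thesis .
  qed
  have count: "(\<Sum>p<L. \<gamma> (k + n) (idx n p)) = (\<Sum>i<L. \<gamma> (k + n) i)"
    if "n \<in> {1..N}" for \<gamma> :: "nat \<Rightarrow> nat \<Rightarrow> nat" and n
    using sum.reindex_bij_betw[OF idx[OF that], of "\<gamma> (k + n)"] .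
  \<comment> \<open>The scheme is prescribed only at sensors of the form \<open>idx n p\<close>;
    surjectivity of \<open>idx n\<close> reaches all of them.\<close>
  have scheme01: "\<gamma>s (k + n) i \<in> {0, 1}" if n: "n \<in> {1..N}" and i: "i < L" for n i
  proof -
    have "i \<in> idx n ` {..<L}" using bij_betw_imp_surj_on[OF idx[OF n]] i by simp
    then obtain p where p: "p < L" "i = idx n p" by blast
    show ?thesis unfolding p(2) scheme[OF n p(1)] by simp
  qed
  have scheme_count: "(\<Sum>i<L. \<gamma>s (k + n) i) = m (k + n)" if n: "n \<in> {1..N}" for n
  proof -
    have "(\<Sum>i<L. \<gamma>s (k + n) i) = (\<Sum>p<L. \<gamma>s (k + n) (idx n p))"
      by (rule count[OF n, symmetric])
    also have "\<dots> = (\<Sum>p<L. if p < m (k + n) then 1 else 0)"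
      by (intro sum.cong refl) (simp add: scheme[OF n])
    also have "\<dots> = m (k + n)" using sum_indicator_prefix[OF m[OF n], where 'a = nat] by simp
    finally show ?thesis .
  qed
  have scheme_feasible: "\<gamma>s \<in> X"
    using scheme01 scheme_count unfolding X_def feasible_def by blast
  have tr_max: "tr_mat (info \<gamma> (k + n)) \<le> tr_mat (info \<gamma>s (k + n))"
    if \<gamma>: "\<gamma> \<in> X" and n: "n \<in> {1..N}" for \<gamma> n
  proof -
    have "idx n p < L" if "p < L" for p
      using bij_betw_apply[OF idx[OF n]] that by auto
    moreover have "(\<Sum>p<L. \<gamma> (k + n) (idx n p)) = m (k + n)"
      using count[OF n, of \<gamma>] \<gamma> n by (simp add: X_def feasible_def)
    ultimately have "tr_mat (info \<gamma> (k + n)) \<le>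
        (\<Sum>p<L. real (if p < m (k + n) then 1 else 0) * a (k + n) (idx n p))"
      unfolding tr_info[OF that] using idx_desc[OF n] m[OF n] sel01[OF that]
      by (intro sum_top_le) auto
    also have "\<dots> = tr_mat (info \<gamma>s (k + n))"
      unfolding tr_info[OF scheme_feasible n] using scheme[OF n] by (intro sum.cong refl) auto
    finally show ?thesis .
  qed
  \<comment> \<open>Obtained without assuming an optimal solution, this serves both parts of the
    claim.\<close>
  have arg_max: "\<forall>n\<in>{1..N}. is_arg_max (\<lambda>\<gamma>. tr_mat (info \<gamma> (k + n))) (\<lambda>\<gamma>. \<gamma> \<in> X) \<gamma>s"
    using scheme_feasible tr_max by (auto simp: is_arg_max_def not_less)
  have step: "P \<gamma> (Suc n) = filter_step (F (k + n)) (Q (k + n)) (P \<gamma> n) (info \<gamma> (k + Suc n))" for \<gamma> n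
    unfolding P_def info_def by (rule err_cov_Suc)
  \<comment> \<open>The induction carries semidefiniteness only, since the initial \<open>P0\<close>
    may be singular; each later covariance is definite.\<close>
  have P: "P \<gamma> n \<in> carrier_mat r r \<and> psd_mat (P \<gamma> n)" if "\<gamma> \<in> X" "n \<le> N" for \<gamma> n
    using that(2)
  proof (induction n)
    case 0
    then show ?case using P0 by (simp add: P_def)
  next
    case (Suc n)
    then have n: "k + n \<in> {k..<k + N}" "Suc n \<in> {1..N}"
      and IH: "P \<gamma> n \<in> carrier_mat r r" "psd_mat (P \<gamma> n)"
      by auto
    have FQ: "F (k + n) \<in> carrier_mat r r" "Q (k + n) \<in> carrier_mat r r" "pd_mat (Q (k + n))"
      using F[OF n(1)] Q[OF n(1)] by auto
    show ?case unfolding step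
      using filter_step_pd[OF FQ IH info[OF that(1) n(2)]] pd_imp_psd by blast
  qed
  have optimal: "loewner_optimal X (\<lambda>\<gamma>. P \<gamma> N) \<gamma>s \<and>
      loewner_optimal X (\<lambda>\<gamma>. mat_sum r r (P \<gamma>) {1..N}) \<gamma>s"
    if opt: "loewner_optimal X (\<lambda>\<gamma>. P \<gamma> N) \<gamma>o" for \<gamma>o
  proof -
    have o: "\<gamma>o \<in> X" and optN: "\<forall>\<gamma>\<in>X. P \<gamma> N \<succeq>\<^sub>L P \<gamma>o N"
      using opt by (auto simp: loewner_optimal_def)
    \<comment> \<open>One downward step: optimality of \<open>\<gamma>o\<close> at time
      \<open>Suc n\<close> passes to time \<open>n\<close> and pins down the information matrix at
      \<open>Suc n\<close>.\<close>
    have descend: "(\<forall>\<gamma>\<in>X. P \<gamma> n \<succeq>\<^sub>L P \<gamma>o n) \<and> info \<gamma>o (k + Suc n) = info \<gamma>s (k + Suc n)"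
      if ge: "\<forall>\<gamma>\<in>X. P \<gamma> (Suc n) \<succeq>\<^sub>L P \<gamma>o (Suc n)" and n: "n < N" for n
    proof
      have FQ: "F (k + n) \<in> carrier_mat r r" "invertible_mat (F (k + n))"
        "Q (k + n) \<in> carrier_mat r r" "pd_mat (Q (k + n))"
        using F[of "k + n"] Q[of "k + n"] n by auto
      have Sn: "Suc n \<in> {1..N}" using n by simp
      \<comment> \<open>The constraints are separate for each time, so one time slice may be
        exchanged between feasible selections.\<close>
      have mixed: "\<gamma>1(k + Suc n := \<gamma>2 (k + Suc n)) \<in> X" if "\<gamma>1 \<in> X" "\<gamma>2 \<in> X" for \<gamma>1 \<gamma>2
        unfolding X_def feasible_def
      proof (intro CollectI ballI)
        fix l assume l: "l \<in> {1..N}"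
        define \<gamma> where "\<gamma> = (if l = Suc n then \<gamma>2 else \<gamma>1)"
        have "(\<gamma>1(k + Suc n := \<gamma>2 (k + Suc n))) (k + l) = \<gamma> (k + l)" by (auto simp: \<gamma>_def)
        moreover have "\<gamma> \<in> X" using that by (simp add: \<gamma>_def)
        ultimately show "(\<forall>i<L. (\<gamma>1(k + Suc n := \<gamma>2 (k + Suc n))) (k + l) i \<in> {0, 1}) \<and>
            (\<Sum>i<L. (\<gamma>1(k + Suc n := \<gamma>2 (k + Suc n))) (k + l) i) = m (k + l)"
          using l unfolding X_def feasible_def by (simp only: mem_Collect_eq) blast
      qed
      \<comment> \<open>The exchanged slice lies after time \<open>n\<close>: the covariance at
        \<open>n\<close> is that of \<open>\<gamma>1\<close>, and only the last information matrix
        comes from \<open>\<gamma>2\<close>.\<close>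
      have P_mixed: "P (\<gamma>1(k + Suc n := \<gamma>2 (k + Suc n))) (Suc n) =
          filter_step (F (k + n)) (Q (k + n)) (P \<gamma>1 n) (info \<gamma>2 (k + Suc n))" for \<gamma>1 \<gamma>2
      proof -
        have "P (\<gamma>1(k + Suc n := \<gamma>2 (k + Suc n))) n = P \<gamma>1 n"
          unfolding P_def by (intro err_cov_cong info_mat_cong) simp
        moreover have "info (\<gamma>1(k + Suc n := \<gamma>2 (k + Suc n))) (k + Suc n) = info \<gamma>2 (k + Suc n)"
          unfolding info_def by (intro info_mat_cong) simp
        ultimately show ?thesis unfolding step by simp
      qed
      have Po: "P \<gamma>o n \<in> carrier_mat r r" "psd_mat (P \<gamma>o n)" using P[OF o] n by auto
      note Co = info[OF o Sn] and Cs = info[OF scheme_feasible Sn]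
      \<comment> \<open>The competitor takes its last slice from \<open>\<gamma>o\<close>; both then
        have the same final information matrix, which cancels.\<close>
      show "\<forall>\<gamma>\<in>X. P \<gamma> n \<succeq>\<^sub>L P \<gamma>o n"
      proof
        fix \<gamma> assume \<gamma>: "\<gamma> \<in> X"
        have P\<gamma>: "P \<gamma> n \<in> carrier_mat r r" "psd_mat (P \<gamma> n)" using P[OF \<gamma>] n by auto
        show "P \<gamma> n \<succeq>\<^sub>L P \<gamma>o n"
          using filter_step_ge_prev[OF FQ(1,3,4,2) P\<gamma> Po Co] ge mixed[OF \<gamma> o] P_mixed[of \<gamma> \<gamma>o]
          by (metis step)
      qed
      \<comment> \<open>Here the competitor is \<open>\<gamma>o\<close> with its last slice taken
        from the scheme, so the previous covariances agree. Maximality of the scheme's trace then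
        forces equality.\<close>
      have "info \<gamma>o (k + Suc n) \<succeq>\<^sub>L info \<gamma>s (k + Suc n)"
        using filter_step_ge_info[OF FQ(1,3,4) Po Cs Co] ge mixed[OF o scheme_feasible]
          P_mixed[of \<gamma>o \<gamma>s] by (metis step)
      then show "info \<gamma>o (k + Suc n) = info \<gamma>s (k + Suc n)"
        using loewner_ge_tr_le[OF Co(1) Cs(1)] tr_max[OF o Sn] by blast
    qed
    \<comment> \<open>Downward induction from the horizon \<open>N\<close> to
      \<open>n\<close>.\<close>
    have ge: "\<forall>\<gamma>\<in>X. P \<gamma> n \<succeq>\<^sub>L P \<gamma>o n" if "n \<le> N" for n
      using that by (induction n rule: inc_induct) (use optN descend in auto)
    have info_same: "info \<gamma>o (k + n) = info \<gamma>s (k + n)" if n: "n \<in> {1..N}" for n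
    proof -
      obtain l where l: "n = Suc l" "l < N" using n by (cases n) auto
      then have "\<forall>\<gamma>\<in>X. P \<gamma> (Suc l) \<succeq>\<^sub>L P \<gamma>o (Suc l)" by (intro ge) simp
      from descend[OF this l(2)] show ?thesis unfolding l(1) by blast
    qed
    \<comment> \<open>The recursion sees the same information matrices at all times, although
      \<open>\<gamma>o\<close> and \<open>\<gamma>s\<close> may select different sensors.\<close>
    have same: "P \<gamma>o n = P \<gamma>s n" if "n \<le> N" for n
      unfolding P_def using info_same that by (intro err_cov_cong) (simp add: info_def)
    \<comment> \<open>One selection minimizes every summand at once, so the sums compare term by
      term.\<close>
    have "mat_sum r r (P \<gamma>) {1..N} \<succeq>\<^sub>L mat_sum r r (P \<gamma>s) {1..N}" if "\<gamma> \<in> X" for \<gamma>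
      using P[OF that] P[OF scheme_feasible] ge that same by (intro mat_sum_loewner_ge) auto
    then show ?thesis
      using ge[of N] same[of N] scheme_feasible by (simp add: loewner_optimal_def)
  qed
  show ?thesis using optimal arg_max by blast
qed

end
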